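(* Let $p\in(0,2]$, $\alpha>1/p-1/2$ and $R>0$. There exists a constant $C(\alpha,p)>0$ depending only on $\alpha$ and $p$ (in particular not on $n$, $r$, $R$, $D$) such that, for all $D\in\{1,\ldots,n\}$, $$\sup_{s\in\mathscr{P}(\alpha,p,R)}\ \inf_{m\in\mathcal{M}_D}\|s-\bar{s}_m\|^2\leq C(\alpha,p)\,nR^2D^{-2\alpha}.$$
   Context: Let $r\geq 2$ be an integer and $n=2^N$ a power of $2$. $\mathscr{M}(r,n)$ is the space of real $r\times n$ matrices; for $t\in\mathscr{M}(r,n)$, $t^{(l)}\in\mathbb{R}^n$ is its $l$-th row and $t_i\in\mathbb{R}^r$ its $i$-th column. It carries the inner product $\langle t,t'\rangle=\sum_{i=1}^n\sum_{l=1}^r t_i^{(l)}t_i'^{(l)}$ with norm $\|\cdot\|$; $\langle\cdot,\cdot\rangle_n$ is the standard inner product on $\mathbb{R}^n$ and $\|\cdot\|_r$ the Euclidean norm on $\mathbb{R}^r$. $\mathscr{P}\subset\mathscr{M}(r,n)$ is the set of matrices all of whose columns are probability distributions on $\{1,\ldots,r\}$. Dyadic partitions. The dyadic intervals of $\{1,\ldots,n\}$ are the sets $\{k2^{N-j}+1,\ldots,(k+1)2^{N-j}\}$, $0\leq j\leq N$, $0\leq k\leq 2^j-1$. $\mathcal{M}$ is the collection of all partitions of $\{1,\ldots,n\}$ into dyadic intervals. For $m\in\mathcal{M}$, $S_m\subset\mathbb{R}^n$ is the linear span of the indicator vectors of the intervals $I\in m$, $D_m=\dim S_m$ (the number of intervals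 in $m$), and $\mathcal{M}_D=\{m\in\mathcal{M}: D_m=D\}$. $\mathbb{R}^r\otimes S_m$ is the subspace of $\mathscr{M}(r,n)$ of matrices whose rows all belong to $S_m$, and $\bar{s}_m$ is the orthogonal projection of $s$ on $\mathbb{R}^r\otimes S_m$. Haar basis and Besov bodies. For $0\leq j\leq N-1$ let $\Lambda(j)=\{(j,k):k=0,\ldots,2^j-1\}$. Let $\varphi:\mathbb{R}\to\{-1,0,1\}$ be equal to $1$ on $(0,1/2]$, $-1$ on $(1/2,1]$ and $0$ elsewhere. For $\lambda=(j,k)\in\Lambda(j)$, $\phi_\lambda\in\mathbb{R}^n$ has $i$-th coordinate $\frac{2^{j/2}}{\sqrt n}\varphi\big(2^j\frac{i}{n}-k\big)$. For $t\in\mathscr{M}(r,n)$ let $\beta_\lambda\in\mathbb{R}^r$ be the column vector with $l$-th coordinate $\beta_\lambda^{(l)}=\langle t^{(l)},\phi_\lambda\rangle_n$. For $\alpha,p,R>0$, $\mathscr{B}(\alpha,p,R)$ is the set of $t\in\mathscr{M}(r,n)$ such that $$\Big(\sum_{j=0}^{N-1}2^{jp(\alpha+1/2-1/p)}\sum_{\lambda\in\Lambda(j)}\|\beta_\lambda\|_r^p\Big)^{1/p}\leq\sqrt{n}\,R,$$ and $\mathscr{P}(\alpha,p,R)=\mathscr{P}\cap\mathscr{B}(\alpha,p,R)$. *)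

theory Defs
  imports
    "HOL-Library.Extended_Real"
    "HOL-Library.Disjoint_Sets"
    "HOL-Library.Indicator_Function"
    "Jordan_Normal_Form.DL_Rank"
begin

text \<open>
  Vectors and matrices are those of the Jordan-Normal-Form library, whose sizes are values, so that
  statements may quantify over \<open>r\<close> and \<open>n\<close>. Library indices start at 0 whereas
  the sets \<open>{1..n}\<close> and the abscissae \<open>i/n\<close> below are 1-based:
  library index \<open>i\<close> stands for the point \<open>Suc i\<close> of \<open>{1..n}\<close>.
\<close>

definition mat_inner :: "real mat \<Rightarrow> real mat \<Rightarrow> real" where
  "mat_inner t t' = (\<Sum>i<dim_col t. \<Sum>l<dim_row t. t $$ (l, i) * t' $$ (l, i))"

definition mat_norm :: "real mat \<Rightarrow> real" where
  "mat_norm t = sqrt (mat_inner t t)"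

definition vec_norm2 :: "real vec \<Rightarrow> real" where
  "vec_norm2 v = sqrt (v \<bullet> v)"

definition prob_mats :: "nat \<Rightarrow> nat \<Rightarrow> real mat set" where
  "prob_mats r n =
     {t \<in> carrier_mat r n. \<forall>i<n. (\<forall>l<r. 0 \<le> t $$ (l, i)) \<and> (\<Sum>l<r. t $$ (l, i)) = 1}"

definition dyadic_intervals :: "nat \<Rightarrow> nat set set" where
  "dyadic_intervals N =
     {{k * 2 ^ (N - j) + 1 .. (k + 1) * 2 ^ (N - j)} | j k. j \<le> N \<and> k < 2 ^ j}"

definition dyadic_partitions :: "nat \<Rightarrow> nat set set set" where
  "dyadic_partitions N = {m. partition_on {1..2 ^ N} m \<and> m \<subseteq> dyadic_intervals N}"

definition indicator_vec :: "nat \<Rightarrow> nat set \<Rightarrow> real vec" where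
  "indicator_vec n I = vec n (\<lambda>i. indicator I (Suc i))"

definition step_space :: "nat \<Rightarrow> nat set set \<Rightarrow> real vec set" where
  "step_space n m =
     LinearCombinations.module.span class_ring (module_vec TYPE(real) n) (indicator_vec n ` m)"

definition step_dim :: "nat \<Rightarrow> nat set set \<Rightarrow> nat" where
  "step_dim n m =
     vectorspace.dim class_ring ((module_vec TYPE(real) n)\<lparr>carrier := step_space n m\<rparr>)"

definition dyadic_partitions_dim :: "nat \<Rightarrow> nat \<Rightarrow> nat set set set" where
  "dyadic_partitions_dim N D = {m \<in> dyadic_partitions N. step_dim (2 ^ N) m = D}"

definition tensor_step_space :: "nat \<Rightarrow> nat \<Rightarrow> nat set set \<Rightarrow> real mat set" where
  "tensor_step_space r n m = {t \<in> carrier_mat r n. \<forall>l<r. row t l \<in> step_space n m}"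

definition orth_proj :: "real mat set \<Rightarrow> real mat \<Rightarrow> real mat" where
  "orth_proj U s = (THE u. u \<in> U \<and> (\<forall>v\<in>U. mat_inner (s - u) v = 0))"

definition haar_mother :: "real \<Rightarrow> real" where
  "haar_mother x = (if 0 < x \<and> x \<le> 1/2 then 1 else if 1/2 < x \<and> x \<le> 1 then -1 else 0)"

definition haar_vec :: "nat \<Rightarrow> nat \<Rightarrow> nat \<Rightarrow> real vec" where
  "haar_vec n j k =
     vec n (\<lambda>i. 2 powr (real j / 2) / sqrt (real n)
                  * haar_mother (2 ^ j * (real (Suc i) / real n) - real k))"

definition haar_coeff :: "real mat \<Rightarrow> nat \<Rightarrow> nat \<Rightarrow> real vec" where
  "haar_coeff t j k = vec (dim_row t) (\<lambda>l. row t l \<bullet> haar_vec (dim_col t) j k)"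

definition besov_body :: "nat \<Rightarrow> nat \<Rightarrow> real \<Rightarrow> real \<Rightarrow> real \<Rightarrow> real mat set" where
  "besov_body r N \<alpha> p R =
     {t \<in> carrier_mat r (2 ^ N).
        (\<Sum>j<N. 2 powr (real j * p * (\<alpha> + 1/2 - 1/p))
                  * (\<Sum>k<2 ^ j. vec_norm2 (haar_coeff t j k) powr p)) powr (1/p)
          \<le> sqrt (2 ^ N) * R}"

definition besov_prob_mats :: "nat \<Rightarrow> nat \<Rightarrow> real \<Rightarrow> real \<Rightarrow> real \<Rightarrow> real mat set" where
  "besov_prob_mats r N \<alpha> p R = prob_mats r (2 ^ N) \<inter> besov_body r N \<alpha> p R"

end

theory Submission
  imports Defs
begin

text \<open>
  The squared distance of \<open>s\<close> to \<open>\<real>\<^sup>r \<otimes> S\<^sub>m\<close> is the sum over \<open>I \<in> m\<close> of the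
  quadratic deviation \<open>V(I)\<close> of \<open>s\<close> from its mean on \<open>I\<close>. Cutting the dyadic interval \<open>I\<close>
  of index \<open>\<lambda>\<close> into halves lowers it by exactly \<open>\<parallel>\<beta>\<^sub>\<lambda>\<parallel>\<^sup>2\<close>, so orthogonality of
  the Haar system is not needed. Put \<open>q = p (\<alpha> + 1/2 - 1/p) > 0\<close>, let \<open>A(I)\<close> be the part of
  the Besov sum carried by \<open>I\<close> and its descendants, and let \<open>G(I) = 2 ^ (-jq) A(I)\<close> for \<open>I\<close> of
  level \<open>j\<close>. As \<open>p/2 \<le> 1\<close>, subadditivity of \<open>x ^ (p/2)\<close> gives \<open>V(I) ^ (p/2) \<le> G(I)\<close>.

  Starting from the whole interval, keep cutting the intervals with \<open>G(I) > \<tau>\<close>. On each level the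
  \<open>A(I)\<close> add up to at most the whole Besov sum, so the number of such \<open>I\<close> decays geometrically in
  the level \<open>j\<close>; it is also at most \<open>2 ^ j\<close>. Hence fewer than \<open>D\<close> cuts are made for some
  \<open>\<tau>\<close> of order \<open>(\<surd>n R) ^ p D ^ (-p (\<alpha> + 1/2))\<close>. The at most \<open>D\<close> resulting cells have
  \<open>V(I) \<le> \<tau> ^ (2/p)\<close>, and further cuts, to reach exactly \<open>D\<close> cells, do not increase the error.
\<close>

text \<open>The shares \<open>u / z\<close> of the total \<open>z = x + y\<close> lie in [0, 1],
  where the exponent \<open>q \<le> 1\<close> only enlarges a number. The two shares add up to 1, so
  scaling back by \<open>z powr q\<close> gives the bound.\<close>

lemma powr_add_le_add_powr:
  fixes x y q :: real
  assumes "0 \<le> x" "0 \<le> y" "0 < q" "q \<le> 1"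
  shows "(x + y) powr q \<le> x powr q + y powr q"
proof (cases "x + y = 0")
  case False
  define z where "z = x + y"
  have z: "z > 0" using False assms unfolding z_def by linarith
  have *: "z powr q * (u / z) \<le> u powr q" if "0 \<le> u" "u \<le> z" for u
  proof -
    have "u / z \<le> (u / z) powr q"
      using powr_mono'[of q 1 "u / z"] that z assms by (cases "u = 0") auto
    then have "z powr q * (u / z) \<le> z powr q * (u / z) powr q"
      by (intro mult_left_mono) auto
    also have "\<dots> = u powr q" using that z by (simp add: powr_divide)
    finally show ?thesis .
  qed
  have "z powr q = z powr q * (x / z) + z powr q * (y / z)"
    using z by (simp add: z_def flip: distrib_left add_divide_distrib)
  also have "\<dots> \<le> x powr q + y powr q"
    using *[of x] *[of y] assms unfolding z_def by auto
  finally show ?thesis unfolding z_def .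
qed auto

subsection \<open>Sums over dyadic subtrees\<close>

text \<open>The descendants of node \<open>(j, k)\<close> at level \<open>j + i\<close> are the \<open>(j + i, k')\<close> with \<open>k' div 2 ^ i = k\<close>.\<close>

definition subtree_sum ::
    "(nat \<Rightarrow> nat \<Rightarrow> 'a :: comm_monoid_add) \<Rightarrow> nat \<Rightarrow> nat \<Rightarrow> nat \<Rightarrow> 'a" where
  "subtree_sum w d j k = (\<Sum>i<d. \<Sum>k'\<in>{k * 2 ^ i..<k * 2 ^ i + 2 ^ i}. w (j + i) k')"

lemma subtree_sum_0 [simp]: "subtree_sum w 0 j k = 0"
  by (simp add: subtree_sum_def)

text \<open>The block of descendants \<open>Suc i\<close> levels below a node is the concatenation
  of the blocks \<open>i\<close> levels below its two children.\<close>

lemma subtree_sum_Suc: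
  "subtree_sum w (Suc d) j k =
     w j k + (subtree_sum w d (Suc j) (2 * k) + subtree_sum w d (Suc j) (2 * k + 1))"
proof -
  have "(\<Sum>k'\<in>{k * 2 ^ Suc i..<k * 2 ^ Suc i + 2 ^ Suc i}. w (j + Suc i) k') =
        (\<Sum>k'\<in>{2 * k * 2 ^ i..<2 * k * 2 ^ i + 2 ^ i}. w (Suc j + i) k') +
        (\<Sum>k'\<in>{(2 * k + 1) * 2 ^ i..<(2 * k + 1) * 2 ^ i + 2 ^ i}. w (Suc j + i) k')" for i
    using sum.atLeastLessThan_concat[of "2 * k * 2 ^ i" "2 * k * 2 ^ i + 2 ^ i"
        "2 * k * 2 ^ i + 2 ^ i + 2 ^ i" "w (Suc (j + i))"]
    by (simp add: algebra_simps)
  then show ?thesis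
    by (simp only: subtree_sum_def sum.lessThan_Suc_shift sum.distrib) simp
qed

lemma subtree_sum_root: "subtree_sum w N 0 0 = (\<Sum>j<N. \<Sum>k<2 ^ j. w j k)"
  by (simp add: subtree_sum_def atLeast0LessThan)

lemma subtree_sum_nonneg:
  fixes w :: "nat \<Rightarrow> nat \<Rightarrow> real"
  assumes "\<And>j k. 0 \<le> w j k"
  shows "0 \<le> subtree_sum w d j k"
  unfolding subtree_sum_def by (intro sum_nonneg assms)

text \<open>Subtrees rooted on one level are disjoint: at each depth their blocks tile the whole
  level \<open>j + i\<close>. Together they cover the levels from \<open>j\<close> on, and the
  levels above contribute nonnegative terms.\<close>

lemma sum_subtree_sum_le_root:
  fixes w :: "nat \<Rightarrow> nat \<Rightarrow> real"
  assumes "\<And>j k. 0 \<le> w j k" "j \<le> N"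
  shows "(\<Sum>k<2 ^ j. subtree_sum w (N - j) j k) \<le> subtree_sum w N 0 0"
proof -
  have "(\<Sum>k<2 ^ j. subtree_sum w (N - j) j k) =
      (\<Sum>i<N - j. \<Sum>k<2 ^ j. \<Sum>k'\<in>{k * 2 ^ i..<k * 2 ^ i + 2 ^ i}. w (j + i) k')"
    unfolding subtree_sum_def by (rule sum.swap)
  also have "\<dots> = (\<Sum>i<N - j. \<Sum>k'<2 ^ (j + i). w (j + i) k')"
    by (simp add: sum.nat_group power_add)
  also have "\<dots> = (\<Sum>i\<in>{j..<N}. \<Sum>k<2 ^ i. w i k)"
    by (rule sum.reindex_bij_witness[of _ "\<lambda>i. i - j" "\<lambda>i. j + i"]) auto
  also have "\<dots> \<le> (\<Sum>i<N. \<Sum>k<2 ^ i. w i k)"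
    by (intro sum_mono2 sum_nonneg assms) auto
  finally show ?thesis by (simp add: subtree_sum_root)
qed

subsection \<open>Dyadic partitions\<close>

text \<open>Addressing intervals by tree nodes lets inductions run over levels: the halves of
  \<open>(j, k)\<close> are \<open>(Suc j, 2 * k)\<close> and
  \<open>(Suc j, 2 * k + 1)\<close>.\<close>

definition dyadic :: "nat \<Rightarrow> nat \<Rightarrow> nat \<Rightarrow> nat set" where
  "dyadic N j k = {k * 2 ^ (N - j) + 1..(k + 1) * 2 ^ (N - j)}"

lemma dyadic_split:
  assumes "j < N"
  shows "dyadic N j k = dyadic N (Suc j) (2 * k) \<union> dyadic N (Suc j) (2 * k + 1)"
    and "dyadic N (Suc j) (2 * k) \<inter> dyadic N (Suc j) (2 * k + 1) = {}"
proof -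
  have "N - j = Suc (N - Suc j)" using assms by simp
  then have "(2::nat) ^ (N - j) = 2 * 2 ^ (N - Suc j)" by simp
  then show "dyadic N j k = dyadic N (Suc j) (2 * k) \<union> dyadic N (Suc j) (2 * k + 1)"
    by (auto simp: dyadic_def algebra_simps)
qed (auto simp: dyadic_def)

lemma dyadic_nonempty [simp]: "dyadic N j k \<noteq> {}" "{} \<noteq> dyadic N j k"
  by (auto simp: dyadic_def)

lemma dyadic_intervals_eq: "dyadic_intervals N = {dyadic N j k | j k. j \<le> N \<and> k < 2 ^ j}"
  by (simp add: dyadic_intervals_def dyadic_def)

lemma finite_dyadic [simp]: "finite (dyadic N j k)"
  by (simp add: dyadic_def)

lemma card_dyadic [simp]: "card (dyadic N j k) = 2 ^ (N - j)"
  by (simp add: dyadic_def)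

lemma dyadic_in_dyadic_intervals:
  "j \<le> N \<Longrightarrow> k < 2 ^ j \<Longrightarrow> dyadic N j k \<in> dyadic_intervals N"
  unfolding dyadic_intervals_eq by blast

section \<open>Building partitions by cutting dyadic cells\<close>

lemma partition_on_Un:
  assumes "partition_on A m" "partition_on B m'" "A \<inter> B = {}"
  shows "partition_on (A \<union> B) (m \<union> m')"
proof -
  have "\<Union>m \<inter> \<Union>m' = {}"
    using assms(3) partition_onD1[OF assms(1)] partition_onD1[OF assms(2)] by simp
  then have "disjoint (m \<union> m')"
    using disjoint_union[OF partition_onD2[OF assms(1)] partition_onD2[OF assms(2)]] by simp
  then show ?thesis
    using assms(1,2) unfolding partition_on_def by simp
qed

text \<open>Recursion from the top: a heavy node above level \<open>N\<close> is cut, any other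
  becomes a cell. Each cut adds one cell and is charged to its heavy node; heavy nodes below a light
  one are counted too, which only weakens the bound.\<close>

lemma adaptive_dyadic_partition:
  assumes P: "\<And>j k. j \<le> N \<Longrightarrow> k < 2 ^ j \<Longrightarrow> j = N \<or> \<not> heavy j k \<Longrightarrow> P (dyadic N j k)"
    and "j + d = N" "k < 2 ^ j"
  shows "\<exists>m. partition_on (dyadic N j k) m \<and> (\<forall>I\<in>m. P I) \<and>
    card m \<le> 1 + subtree_sum (\<lambda>j k. of_bool (heavy j k)) d j k"
  using assms(2,3)
proof (induction d arbitrary: j k)
  case 0
  then show ?case
    using P[of j k] by (intro exI[of _ "{dyadic N j k}"]) (auto simp: partition_on_space)
next
  case (Suc d)
  show ?case
  proof (cases "heavy j k")
    case False
    then have "P (dyadic N j k)" using P Suc.prems by simp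
    then show ?thesis
      by (intro exI[of _ "{dyadic N j k}"]) (simp add: partition_on_space)
  next
    case True
    have "Suc j + d = N" "2 * k < 2 ^ Suc j" "2 * k + 1 < 2 ^ Suc j" "j < N"
      using Suc.prems by auto
    note IH = Suc.IH[OF this(1,2)] Suc.IH[OF this(1,3)] and split = dyadic_split[OF \<open>j < N\<close>, of k]
    from IH obtain m m' where
      m: "partition_on (dyadic N (Suc j) (2 * k)) m" "\<forall>I\<in>m. P I"
         "card m \<le> 1 + subtree_sum (\<lambda>j k. of_bool (heavy j k)) d (Suc j) (2 * k)" and
      m': "partition_on (dyadic N (Suc j) (2 * k + 1)) m'" "\<forall>I\<in>m'. P I"
         "card m' \<le> 1 + subtree_sum (\<lambda>j k. of_bool (heavy j k)) d (Suc j) (2 * k + 1)"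
      by blast
    have "partition_on (dyadic N j k) (m \<union> m')"
      unfolding split(1) by (rule partition_on_Un[OF m(1) m'(1) split(2)])
    moreover have "card (m \<union> m') \<le> 1 + subtree_sum (\<lambda>j k. of_bool (heavy j k)) (Suc d) j k"
      using card_Un_le[of m m'] m(3) m'(3) True unfolding subtree_sum_Suc by simp
    ultimately show ?thesis using m(2) m'(2) by blast
  qed
qed

text \<open>One cell is halved at a time. This adds exactly one cell, and the total of
  \<open>V\<close> cannot grow because the halves together have at most the value of the cell that
  they replace.\<close>

lemma refine_dyadic_partition_to_card:
  fixes V :: "nat set \<Rightarrow> real"
  assumes split: "\<And>j k. j < N \<Longrightarrow> k < 2 ^ j \<Longrightarrow>
      V (dyadic N (Suc j) (2 * k)) + V (dyadic N (Suc j) (2 * k + 1)) \<le> V (dyadic N j k)"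
    and m: "m \<in> dyadic_partitions N" and "card m \<le> D" "D \<le> 2 ^ N"
  shows "\<exists>m'\<in>dyadic_partitions N. card m' = D \<and> (\<Sum>I\<in>m'. V I) \<le> (\<Sum>I\<in>m. V I)"
  using assms(3,4)
proof (induction rule: dec_induct)
  case base
  then show ?case using m by auto
next
  case (step D)
  then obtain m' where m': "m' \<in> dyadic_partitions N" "card m' = D"
    "(\<Sum>I\<in>m'. V I) \<le> (\<Sum>I\<in>m. V I)" by auto
  have part: "partition_on {1..2 ^ N} m'" and sub: "m' \<subseteq> dyadic_intervals N"
    using m'(1) by (auto simp: dyadic_partitions_def)
  have fin: "finite m'" using finite_elements[OF _ part] by simp
  \<comment> \<open>If all cells were singletons there would be \<open>2 ^ N\<close> of them,
    whereas there are only \<open>D < 2 ^ N\<close>.\<close>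
  have "\<exists>I\<in>m'. card I \<noteq> 1"
  proof (rule ccontr)
    assume "\<not> ?thesis"
    then have "(\<Sum>I\<in>m'. card I) = card m'" by simp
    moreover have "card {1..2 ^ N :: nat} = (\<Sum>I\<in>m'. card I)"
      using part sub by (intro product_partition) (auto simp: dyadic_intervals_eq)
    ultimately show False using m'(2) step.prems by simp
  qed
  then obtain j k where jk: "dyadic N j k \<in> m'" "card (dyadic N j k) \<noteq> 1" "j \<le> N" "k < 2 ^ j"
    using sub unfolding dyadic_intervals_eq by blast
  have "j < N" using jk(2,3) by (cases "j = N") auto
  note sp = dyadic_split[OF this, of k]
  let ?I = "dyadic N j k" and ?A = "dyadic N (Suc j) (2 * k)"
    and ?B = "dyadic N (Suc j) (2 * k + 1)"
  let ?m = "insert ?A (insert ?B (m' - {?I}))"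
  have rest: "partition_on ({1..2 ^ N} - ?I) (m' - {?I})" and I: "?I \<subseteq> {1..2 ^ N}"
    using part jk(1) partition_on_insert[of ?I "m' - {?I}" "{1..2 ^ N}"]
    by (auto simp: insert_absorb partition_on_def disjoint_def disjnt_def)
  have AB: "partition_on ?I {?A, ?B}"
    using sp by (auto simp: partition_on_def disjoint_def)
  have union: "({1..2 ^ N} - ?I) \<union> ?I = {1..2 ^ N}" using I by blast
  have "partition_on {1..2 ^ N} ((m' - {?I}) \<union> {?A, ?B})"
    using partition_on_Un[OF rest AB] unfolding union by blast
  moreover have "(m' - {?I}) \<union> {?A, ?B} = ?m" by blast
  moreover have "?A \<in> dyadic_intervals N" "?B \<in> dyadic_intervals N"
    using \<open>j < N\<close> jk(4) by (intro dyadic_in_dyadic_intervals; simp)+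
  ultimately have mem: "?m \<in> dyadic_partitions N"
    using sub unfolding dyadic_partitions_def by auto
  \<comment> \<open>The two halves are really new cells, so neither the cardinality nor the sum over
    the new partition loses a term by coincidence.\<close>
  have new: "X \<notin> m' - {?I}" if "X \<subseteq> ?I" "X \<noteq> {}" for X
  proof
    assume "X \<in> m' - {?I}"
    then have "X \<subseteq> {1..2 ^ N} - ?I" using partition_onD1[OF rest] by blast
    then show False using that by blast
  qed
  have "?A \<notin> m' - {?I}" "?B \<notin> m' - {?I}"
    using sp(1) by (intro new; simp)+
  moreover have "?A \<noteq> ?B" using sp(2) by (metis Int_absorb dyadic_nonempty(1))
  ultimately have AB_new: "?B \<notin> m' - {?I}" "?A \<notin> insert ?B (m' - {?I})" by blast+
  have "card ?m = Suc (Suc (card (m' - {?I})))"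
    using fin AB_new by simp
  also have "\<dots> = Suc D" using fin jk(1) m'(2) by (metis card.remove)
  finally have card: "card ?m = Suc D" .
  have "(\<Sum>I\<in>?m. V I) = V ?A + V ?B + (\<Sum>I\<in>m' - {?I}. V I)"
    using fin AB_new by simp
  also have "\<dots> \<le> V ?I + (\<Sum>I\<in>m' - {?I}. V I)"
    using split[OF \<open>j < N\<close> jk(4)] by simp
  also have "\<dots> = (\<Sum>I\<in>m'. V I)"
    using fin jk(1) by (simp add: sum.remove)
  finally show ?case using mem card m'(3) by (intro bexI[of _ ?m]) auto
qed

subsection \<open>Deviation from the mean and Haar coefficients\<close>

definition sq_dev :: "('a \<Rightarrow> real) \<Rightarrow> 'a set \<Rightarrow> real" where
  "sq_dev f I = (\<Sum>i\<in>I. (f i - sum f I / card I)\<^sup>2)"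

lemma sq_dev_nonneg: "0 \<le> sq_dev f I"
  unfolding sq_dev_def by (simp add: sum_nonneg)

lemma sq_dev_eq:
  assumes "finite I" "I \<noteq> {}"
  shows "sq_dev f I = (\<Sum>i\<in>I. (f i)\<^sup>2) - (sum f I)\<^sup>2 / card I"
proof -
  define c where "c = real (card I)"
  have c: "c \<noteq> 0" using assms by (simp add: c_def)
  define \<mu> where "\<mu> = sum f I / c"
  have "sq_dev f I = (\<Sum>i\<in>I. (f i)\<^sup>2 - 2 * \<mu> * f i + \<mu>\<^sup>2)"
    by (simp add: sq_dev_def c_def \<mu>_def power2_diff algebra_simps)
  also have "\<dots> = (\<Sum>i\<in>I. (f i)\<^sup>2) - 2 * \<mu> * sum f I + c * \<mu>\<^sup>2"
    by (simp add: sum.distrib sum_subtractf c_def sum_distrib_left)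
  also have "\<dots> = (\<Sum>i\<in>I. (f i)\<^sup>2) - (sum f I)\<^sup>2 / c"
    using c by (simp add: \<mu>_def power2_eq_square field_simps)
  finally show ?thesis by (simp add: c_def)
qed

text \<open>With \<open>a\<close>, \<open>b\<close> the sums of \<open>f\<close> over the halves and
  \<open>c\<close> their common size, the sums of squares cancel in the form of
  \<open>sq_dev_eq\<close>. What remains is a^2/c + b^2/c - (a + b)^2/(2c) = (a - b)^2/(2c).\<close>

lemma sq_dev_split:
  assumes "finite A" "finite B" "A \<inter> B = {}" "A \<noteq> {}" "card B = card A"
  shows "sq_dev f (A \<union> B) =
    (sum f A - sum f B)\<^sup>2 / (2 * card A) + (sq_dev f A + sq_dev f B)"
proof -
  define c where "c = real (card A)"
  have c: "c \<noteq> 0" using assms by (simp add: c_def)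
  have "B \<noteq> {}" "card (A \<union> B) = 2 * card A"
    using assms by (auto simp: card_Un_disjoint)
  then show ?thesis
    using assms c
    by (simp add: sq_dev_eq sum.union_disjoint flip: c_def)
       (simp add: power2_eq_square field_simps)
qed

text \<open>This is V(I) of the opening comment. The shift \<open>i - 1\<close> turns a point of the
  1-based interval into a 0-based column index.\<close>

definition mat_dev :: "real mat \<Rightarrow> nat set \<Rightarrow> real" where
  "mat_dev s I = (\<Sum>l<dim_row s. sq_dev (\<lambda>i. s $$ (l, i - 1)) I)"

lemma mat_dev_nonneg: "0 \<le> mat_dev s I"
  unfolding mat_dev_def by (intro sum_nonneg sq_dev_nonneg)

lemma mat_dev_dyadic_finest: "mat_dev s (dyadic N N k) = 0"
  by (simp add: mat_dev_def dyadic_def sq_dev_def)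

section \<open>Haar coefficients as differences between halves\<close>

lemma dyadic_subset:
  assumes "j \<le> N" "k < 2 ^ j"
  shows "dyadic N j k \<subseteq> {1..2 ^ N}"
proof -
  have "(k + 1) * 2 ^ (N - j) \<le> 2 ^ j * (2::nat) ^ (N - j)"
    using assms by (intro mult_right_mono) auto
  also have "\<dots> = 2 ^ N" using assms by (simp flip: power_add)
  finally show ?thesis by (auto simp: dyadic_def)
qed

lemma power_two_level_split:
  assumes "j < N"
  shows "(2 :: 'a :: comm_semiring_1) ^ N = 2 ^ j * (2 * 2 ^ (N - Suc j))"
proof -
  have "N = j + Suc (N - Suc j)" using assms by simp
  then have "(2 :: 'a) ^ N = 2 ^ (j + Suc (N - Suc j))" by simp
  then show ?thesis unfolding power_add power_Suc .
qed

text \<open>With \<open>h\<close> half the length of the dyadic interval, the argument is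
  \<open>i / (2 * h) - k\<close>, and the thresholds 0, 1/2, 1 are met at \<open>2 * k * h\<close>,
  \<open>(2 * k + 1) * h\<close>, \<open>(2 * k + 2) * h\<close>. Both the pieces of the mother
  function and the dyadic intervals exclude their left and include their right end.\<close>

lemma haar_mother_dyadic:
  assumes "j < N"
  shows "haar_mother (2 ^ j * (real i / real (2 ^ N)) - real k) =
    indicator (dyadic N (Suc j) (2 * k)) i - indicator (dyadic N (Suc j) (2 * k + 1)) i"
proof -
  define h :: nat where "h = 2 ^ (N - Suc j)"
  have h: "h > 0" by (simp add: h_def)
  have "(2::real) ^ N = 2 ^ j * (2 * real h)"
    using power_two_level_split[OF assms] by (simp add: h_def)
  then have x: "2 ^ j * (real i / real (2 ^ N)) - real k = real i / (2 * real h) - real k"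
    by simp
  have "0 < real i / (2 * real h) - real k \<longleftrightarrow> real (2 * k * h) < real i"
    "real i / (2 * real h) - real k \<le> 1 / 2 \<longleftrightarrow> real i \<le> real ((2 * k + 1) * h)"
    "real i / (2 * real h) - real k \<le> 1 \<longleftrightarrow> real i \<le> real ((2 * k + 1 + 1) * h)"
    using h by (auto simp: field_simps)
  then show ?thesis
    unfolding x haar_mother_def dyadic_def h_def[symmetric] of_nat_less_iff of_nat_le_iff
    by (auto simp: indicator_def algebra_simps)
qed

lemma haar_coeff_index:
  assumes s: "s \<in> carrier_mat r (2 ^ N)" and "l < r" "j < N" "k < 2 ^ j"
  shows "haar_coeff s j k $ l = 2 powr (real j / 2) / sqrt (2 ^ N) *
    ((\<Sum>i\<in>dyadic N (Suc j) (2 * k). s $$ (l, i - 1)) -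
     (\<Sum>i\<in>dyadic N (Suc j) (2 * k + 1). s $$ (l, i - 1)))"
proof -
  let ?A = "dyadic N (Suc j) (2 * k)" and ?B = "dyadic N (Suc j) (2 * k + 1)"
  let ?c = "2 powr (real j / 2) / sqrt (2 ^ N)"
  have sub: "?A \<subseteq> {1..2 ^ N}" "?B \<subseteq> {1..2 ^ N}"
    using assms by (intro dyadic_subset; simp)+
  \<comment> \<open>Writing the column as \<open>Suc i - 1\<close> makes the summand a function of
    \<open>Suc i\<close>, ready for the shift of the sum to \<open>{1..2 ^ N}\<close>.\<close>
  have "haar_coeff s j k $ l =
      (\<Sum>i<2 ^ N. s $$ (l, Suc i - 1) * (?c * (indicator ?A (Suc i) - indicator ?B (Suc i))))"
    using assms haar_mother_dyadic[OF \<open>j < N\<close>, where k = k]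
    by (simp add: haar_coeff_def haar_vec_def scalar_prod_def atLeast0LessThan del: of_nat_Suc)
  also have "\<dots> = (\<Sum>i\<in>{1..2 ^ N}. s $$ (l, i - 1) * (?c * (indicator ?A i - indicator ?B i)))"
    unfolding One_nat_def by (rule sum.atLeast1_atMost_eq[symmetric])
  also have "\<dots> = ?c * ((\<Sum>i\<in>{1..2 ^ N}. s $$ (l, i - 1) * indicator ?A i) -
      (\<Sum>i\<in>{1..2 ^ N}. s $$ (l, i - 1) * indicator ?B i))"
    unfolding right_diff_distrib sum_subtractf sum_distrib_left
    by (simp only: mult.left_commute)
  also have "(\<Sum>i\<in>{1..2 ^ N}. s $$ (l, i - 1) * indicator ?A i) = (\<Sum>i\<in>?A. s $$ (l, i - 1))"
    using sub by (simp add: sum_mult_indicator Int_absorb1)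
  also have "(\<Sum>i\<in>{1..2 ^ N}. s $$ (l, i - 1) * indicator ?B i) = (\<Sum>i\<in>?B. s $$ (l, i - 1))"
    using sub by (simp add: sum_mult_indicator Int_absorb1)
  finally show ?thesis .
qed

lemma vec_norm2_sq: "(vec_norm2 v)\<^sup>2 = (\<Sum>l<dim_vec v. (v $ l)\<^sup>2)"
  unfolding vec_norm2_def
  by (simp add: scalar_prod_def atLeast0LessThan power2_eq_square sum_nonneg)

text \<open>Row by row this is \<open>sq_dev_split\<close>. The squared Haar normalisation
  \<open>2 ^ j / 2 ^ N\<close> is the reciprocal of the size of the interval, that is
  \<open>1 / (2 * card A)\<close> for a half \<open>A\<close>, so the squared coefficient is exactly
  the term between the halves.\<close>

lemma mat_dev_dyadic_split:
  assumes s: "s \<in> carrier_mat r (2 ^ N)" and "j < N" "k < 2 ^ j"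
  shows "mat_dev s (dyadic N j k) = (vec_norm2 (haar_coeff s j k))\<^sup>2 +
    (mat_dev s (dyadic N (Suc j) (2 * k)) + mat_dev s (dyadic N (Suc j) (2 * k + 1)))"
proof -
  let ?A = "dyadic N (Suc j) (2 * k)" and ?B = "dyadic N (Suc j) (2 * k + 1)"
  let ?f = "\<lambda>l i. s $$ (l, i - 1)"
  note split = dyadic_split[OF \<open>j < N\<close>, of k]
  have scale: "(2 powr (real j / 2) / sqrt (2 ^ N))\<^sup>2 = 1 / (2 * 2 ^ (N - Suc j) :: real)"
  proof -
    have "(2::real) ^ N = 2 ^ j * (2 * 2 ^ (N - Suc j))"
      by (rule power_two_level_split[OF \<open>j < N\<close>])
    moreover have "(2 powr (real j / 2))\<^sup>2 = (2::real) ^ j"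
      by (simp add: power2_eq_square powr_realpow flip: powr_add)
    ultimately show ?thesis by (simp add: power_divide)
  qed
  have "(vec_norm2 (haar_coeff s j k))\<^sup>2 = (\<Sum>l<r. (haar_coeff s j k $ l)\<^sup>2)"
    using s by (simp add: vec_norm2_sq haar_coeff_def)
  also have "\<dots> = (\<Sum>l<r. (sum (?f l) ?A - sum (?f l) ?B)\<^sup>2 / (2 * real (card ?A)))"
    by (intro sum.cong refl, unfold lessThan_iff,
        unfold haar_coeff_index[OF s _ assms(2,3)] power_mult_distrib scale) simp
  finally have "(vec_norm2 (haar_coeff s j k))\<^sup>2 + (mat_dev s ?A + mat_dev s ?B) =
      (\<Sum>l<r. sq_dev (?f l) (?A \<union> ?B))"
    using s split(2) by (simp add: mat_dev_def sq_dev_split sum.distrib)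
  then show ?thesis using s split(1) by (simp add: mat_dev_def)
qed

subsection \<open>Projection onto step functions\<close>

lemma indicator_vec_carrier [simp]: "indicator_vec n I \<in> carrier_vec n"
  by (simp add: indicator_vec_def)

text \<open>Cells lie in \<open>{1..n}\<close>, so an indicator vector determines its cell. Hence
  sums and cardinalities over the image can be taken over \<open>m\<close>.\<close>

lemma indicator_vec_inj_on:
  assumes "partition_on {1..n} m"
  shows "inj_on (indicator_vec n) m"
proof (rule inj_onI)
  fix I J assume IJ: "I \<in> m" "J \<in> m" "indicator_vec n I = indicator_vec n J"
  have "i \<in> I \<longleftrightarrow> i \<in> J" if "i \<in> {1..n}" for i
  proof -
    have "indicator_vec n I $ (i - 1) = indicator_vec n J $ (i - 1)" using IJ(3) by simp
    then have "(indicator I i :: real) = indicator J i"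
      using that by (cases i) (simp_all add: indicator_vec_def)
    then show ?thesis by (auto simp: indicator_def split: if_splits)
  qed
  moreover have "I \<subseteq> {1..n}" "J \<subseteq> {1..n}"
    using IJ partition_onD1[OF assms] by blast+
  ultimately show "I = J" by blast
qed

lemma partition_on_unique_cell:
  assumes "partition_on A m" "I \<in> m" "J \<in> m" "i \<in> I" "i \<in> J"
  shows "I = J"
  using assms disjointD[OF partition_onD2[OF assms(1)], of I J] by blast

text \<open>The explicit candidate for the orthogonal projection: each entry is replaced by the mean
  of its row over the unique cell containing its column.\<close>

definition cell_mean :: "nat \<Rightarrow> nat set set \<Rightarrow> real mat \<Rightarrow> real mat" where
  "cell_mean n m s = mat (dim_row s) n (\<lambda>(l, i).
     let I = (THE I. I \<in> m \<and> Suc i \<in> I) in (\<Sum>i\<in>I. s $$ (l, i - 1)) / card I)"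

lemma cell_mean_carrier: "s \<in> carrier_mat r n \<Longrightarrow> cell_mean n m s \<in> carrier_mat r n"
  by (auto simp: cell_mean_def)

context
  fixes n :: nat and m :: "nat set set"
  assumes part: "partition_on {1..n} m"
begin

interpretation V: vec_space "TYPE(real)" n .

lemma finite_partition: "finite m"
  using finite_elements[OF _ part] by simp

lemma cell_subset: "I \<in> m \<Longrightarrow> I \<subseteq> {1..n}"
  using partition_onD1[OF part] by blast

lemma finite_cell: "I \<in> m \<Longrightarrow> finite I"
  using cell_subset finite_subset by blast

lemma cell_index_less: "I \<in> m \<Longrightarrow> Suc i \<in> I \<Longrightarrow> i < n"
  using cell_subset by fastforce

lemma obtain_cell:
  assumes "I \<in> m"
  obtains i where "Suc i \<in> I" "i < n"
proof -
  have "I \<noteq> {}" "I \<subseteq> {1..n}" using partition_onD1[OF part] partition_onD3[OF part] assms by auto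
  then obtain i' where "i' \<in> I" "1 \<le> i'" "i' \<le> n" by fastforce
  then show ?thesis using that[of "i' - 1"] by simp
qed

text \<open>Cells are disjoint, so at a point of \<open>I\<close> all other indicators
  vanish.\<close>

lemma lincomb_indicator_vec_index:
  assumes "I \<in> m" "Suc i \<in> I"
  shows "V.lincomb a (indicator_vec n ` m) $ i = a (indicator_vec n I)"
proof -
  have "Suc i \<in> {1..n}" using assms partition_onD1[OF part] by blast
  then have i: "i < n" by simp
  have "V.lincomb a (indicator_vec n ` m) $ i = (\<Sum>x\<in>indicator_vec n ` m. a x * x $ i)"
    by (rule V.lincomb_index[OF i]) auto
  also have "\<dots> = (\<Sum>J\<in>m. a (indicator_vec n J) * indicator J (Suc i))"
    unfolding sum.reindex[OF indicator_vec_inj_on[OF part]]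
    using i by (simp add: indicator_vec_def)
  also have "\<dots> = (\<Sum>J\<in>m. if J = I then a (indicator_vec n I) else 0)"
    using assms partition_on_unique_cell[OF part, of I]
    by (intro sum.cong) (auto simp: indicator_def)
  also have "\<dots> = a (indicator_vec n I)"
    using finite_partition assms by simp
  finally show ?thesis .
qed

text \<open>Evaluating a vanishing combination at one point of each nonempty cell kills every
  coefficient, so the indicators are a basis of their span. The dimension constraint thereby becomes
  a count of cells.\<close>

lemma step_dim_eq_card: "step_dim n m = card m"
proof -
  let ?S = "indicator_vec n ` m"
  have "V.lin_indpt ?S"
  proof (rule V.finite_lin_indpt2)
    show "finite ?S" using finite_partition by simp
    show "?S \<subseteq> carrier_vec n" by auto
    fix a assume 0: "V.lincomb a ?S = 0\<^sub>v n"
    show "\<forall>v\<in>?S. a v = 0"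
    proof
      fix v assume "v \<in> ?S"
      then obtain I where I: "I \<in> m" "v = indicator_vec n I" by blast
      obtain i where i: "Suc i \<in> I" "i < n" using obtain_cell[OF I(1)] .
      show "a v = 0"
        using lincomb_indicator_vec_index[OF I(1) i(1), of a] I(2) 0 i(2) by simp
    qed
  qed
  then have "maximal ?S (\<lambda>T. T \<subseteq> ?S \<and> V.lin_indpt T)"
    by (auto simp: maximal_def)
  then have "step_dim n m = card ?S"
    unfolding step_dim_def step_space_def using finite_partition
    by (intro V.dim_span) auto
  then show ?thesis by (simp add: card_image indicator_vec_inj_on[OF part])
qed

lemma step_space_eq:
  "step_space n m =
     {v \<in> carrier_vec n. \<forall>I\<in>m. \<forall>i i'. Suc i \<in> I \<longrightarrow> Suc i' \<in> I \<longrightarrow> v $ i = v $ i'}"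
proof -
  let ?S = "indicator_vec n ` m"
  have span: "step_space n m = {v. \<exists>a. v = V.lincomb a ?S}"
    unfolding step_space_def using finite_partition by (intro V.finite_span) auto
  show ?thesis
  proof (intro equalityI subsetI)
    fix v assume "v \<in> step_space n m"
    then obtain a where a: "v = V.lincomb a ?S" unfolding span by blast
    have "v \<in> carrier_vec n"
      unfolding a using finite_partition by (intro carrier_vecI V.lincomb_dim) auto
    moreover have "v $ i = v $ i'" if "I \<in> m" "Suc i \<in> I" "Suc i' \<in> I" for I i i'
      using that by (simp add: a lincomb_indicator_vec_index)
    ultimately show "v \<in> {v \<in> carrier_vec n.
        \<forall>I\<in>m. \<forall>i i'. Suc i \<in> I \<longrightarrow> Suc i' \<in> I \<longrightarrow> v $ i = v $ i'}"
      by blast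
  next
    fix v :: "real vec" assume v: "v \<in> {v \<in> carrier_vec n.
        \<forall>I\<in>m. \<forall>i i'. Suc i \<in> I \<longrightarrow> Suc i' \<in> I \<longrightarrow> v $ i = v $ i'}"
    \<comment> \<open>The coefficient of a cell is the value of \<open>v\<close> at any point of it.
      Coefficients are indexed by vectors, so the cell is first recovered from its
      indicator.\<close>
    define a :: "real vec \<Rightarrow> real"
      where "a w = (v $ (SOME i. Suc i \<in> the_inv_into m (indicator_vec n) w))" for w
    have "V.lincomb a ?S $ i = v $ i" if "i < n" for i
    proof -
      have "Suc i \<in> \<Union>m" using that by (simp flip: partition_onD1[OF part])
      then obtain I where I: "I \<in> m" "Suc i \<in> I" by blast
      have "Suc (SOME i. Suc i \<in> I) \<in> I" using I(2) by (rule someI)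
      then have "v $ (SOME i. Suc i \<in> I) = v $ i" using v I by blast
      then show ?thesis
        using I lincomb_indicator_vec_index[OF I]
        by (simp add: a_def the_inv_into_f_f[OF indicator_vec_inj_on[OF part]])
    qed
    then have "v = V.lincomb a ?S"
      using v finite_partition
      by (intro eq_vecI) (auto simp: V.lincomb_dim image_subset_iff)
    then show "v \<in> step_space n m" unfolding span by auto
  qed
qed

section \<open>Orthogonal projection as averaging over cells\<close>

lemma sum_over_partition: "(\<Sum>i<n. g (Suc i)) = (\<Sum>I\<in>m. \<Sum>i\<in>I. g i)"
proof -
  have "(\<Sum>i<n. g (Suc i)) = sum g (\<Union>m)"
    unfolding partition_onD1[OF part, symmetric] One_nat_def
    by (rule sum.atLeast1_atMost_eq[symmetric])
  also have "\<dots> = (\<Sum>I\<in>m. sum g I)"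
    using partition_onD2[OF part] finite_cell
    by (subst sum.Union_disjoint_sets) auto
  finally show ?thesis .
qed

lemma cell_mean_index:
  assumes "l < dim_row s" "I \<in> m" "Suc i \<in> I"
  shows "cell_mean n m s $$ (l, i) = (\<Sum>i\<in>I. s $$ (l, i - 1)) / card I"
proof -
  have "i < n" using assms cell_index_less by blast
  moreover have "(THE I. I \<in> m \<and> Suc i \<in> I) = I"
    using assms partition_on_unique_cell[OF part] by (intro the_equality) auto
  ultimately show ?thesis using assms(1) by (simp add: cell_mean_def)
qed

lemma tensor_step_space_eq:
  "tensor_step_space r n m = {t \<in> carrier_mat r n. \<forall>l<r. \<forall>I\<in>m. \<forall>i i'.
     Suc i \<in> I \<longrightarrow> Suc i' \<in> I \<longrightarrow> t $$ (l, i) = t $$ (l, i')}"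
proof (intro equalityI subsetI)
  fix t :: "real mat" assume t: "t \<in> tensor_step_space r n m"
  have "t $$ (l, i) = t $$ (l, i')" if "l < r" "I \<in> m" "Suc i \<in> I" "Suc i' \<in> I" for l I i i'
  proof -
    have "row t l $ i = row t l $ i'"
      using t that unfolding tensor_step_space_def step_space_eq by blast
    moreover have "i < n" "i' < n" using that cell_index_less by blast+
    moreover have "t \<in> carrier_mat r n" using t by (simp add: tensor_step_space_def)
    ultimately show ?thesis using \<open>l < r\<close> by simp
  qed
  moreover have "t \<in> carrier_mat r n" using t by (simp add: tensor_step_space_def)
  ultimately show "t \<in> {t \<in> carrier_mat r n. \<forall>l<r. \<forall>I\<in>m. \<forall>i i'.
     Suc i \<in> I \<longrightarrow> Suc i' \<in> I \<longrightarrow> t $$ (l, i) = t $$ (l, i')}"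
    by blast
next
  fix t :: "real mat" assume t: "t \<in> {t \<in> carrier_mat r n. \<forall>l<r. \<forall>I\<in>m. \<forall>i i'.
     Suc i \<in> I \<longrightarrow> Suc i' \<in> I \<longrightarrow> t $$ (l, i) = t $$ (l, i')}"
  have "row t l \<in> carrier_vec n" if "l < r" for l
    using t that by auto
  moreover have "row t l $ i = row t l $ i'" if "l < r" "I \<in> m" "Suc i \<in> I" "Suc i' \<in> I" for l I i i'
  proof -
    have "t $$ (l, i) = t $$ (l, i')" using t that by blast
    moreover have "i < n" "i' < n" using that cell_index_less by blast+
    moreover have "t \<in> carrier_mat r n" using t by simp
    ultimately show ?thesis using \<open>l < r\<close> by simp
  qed
  moreover have "t \<in> carrier_mat r n" using t by simp
  ultimately show "t \<in> tensor_step_space r n m"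
    unfolding tensor_step_space_def step_space_eq by blast
qed

lemma cell_mean_in_tensor_step_space:
  assumes "s \<in> carrier_mat r n"
  shows "cell_mean n m s \<in> tensor_step_space r n m"
  using assms unfolding tensor_step_space_eq
  by (auto simp: cell_mean_index cell_mean_carrier)

lemma mat_inner_over_partition:
  assumes "t \<in> carrier_mat r n"
  shows "mat_inner t t' = (\<Sum>l<r. \<Sum>I\<in>m. \<Sum>i\<in>I. t $$ (l, i - 1) * t' $$ (l, i - 1))"
proof -
  have "mat_inner t t' = (\<Sum>l<r. \<Sum>i<n. t $$ (l, Suc i - 1) * t' $$ (l, Suc i - 1))"
    using assms unfolding mat_inner_def by (subst sum.swap) simp
  also have "\<dots> = (\<Sum>l<r. \<Sum>I\<in>m. \<Sum>i\<in>I. t $$ (l, i - 1) * t' $$ (l, i - 1))"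
    by (intro sum.cong refl sum_over_partition)
  finally show ?thesis .
qed

lemma minus_cell_mean_index:
  assumes "s \<in> carrier_mat r n" "l < r" "I \<in> m" "i \<in> I"
  shows "(s - cell_mean n m s) $$ (l, i - 1) =
    s $$ (l, i - 1) - (\<Sum>i\<in>I. s $$ (l, i - 1)) / card I"
proof -
  have "i \<in> {1..n}" using assms cell_subset by blast
  then obtain i' where "i = Suc i'" "i' < n" by (cases i) auto
  then show ?thesis
    using assms cell_mean_index[of l s I i'] cell_mean_carrier[OF assms(1), of m] by simp
qed

text \<open>On each cell a row of \<open>v\<close> is constant while the deviations of
  \<open>s\<close> from the mean sum to zero.\<close>

lemma cell_mean_orthogonal:
  assumes s: "s \<in> carrier_mat r n" and v: "v \<in> tensor_step_space r n m"
  shows "mat_inner (s - cell_mean n m s) v = 0"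
proof -
  have "(\<Sum>i\<in>I. (s - cell_mean n m s) $$ (l, i - 1) * v $$ (l, i - 1)) = 0"
    if lI: "l < r" "I \<in> m" for l I
  proof -
    obtain i0 where i0: "Suc i0 \<in> I" using obtain_cell[OF lI(2)] by metis
    \<comment> \<open>Cells do not contain 0, so \<open>i - 1\<close> is a true predecessor and not
      a truncated one.\<close>
    have pos: "i \<ge> 1" if "i \<in> I" for i using that cell_subset[OF lI(2)] by force
    have "card I \<noteq> 0"
      using i0 finite_cell[OF lI(2)] by auto
    then have 0: "(\<Sum>i\<in>I. s $$ (l, i - 1) - (\<Sum>i\<in>I. s $$ (l, i - 1)) / card I) = 0"
      by (simp add: sum_subtractf)
    have "v $$ (l, i - 1) = v $$ (l, i0)" if "i \<in> I" for i
    proof -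
      have "Suc (i - 1) \<in> I" using pos[OF that] that by simp
      then show ?thesis using v \<open>l < r\<close> \<open>I \<in> m\<close> i0 unfolding tensor_step_space_eq by blast
    qed
    then have "(\<Sum>i\<in>I. (s - cell_mean n m s) $$ (l, i - 1) * v $$ (l, i - 1)) =
        (\<Sum>i\<in>I. (s $$ (l, i - 1) - (\<Sum>i\<in>I. s $$ (l, i - 1)) / card I) * v $$ (l, i0))"
      using minus_cell_mean_index[OF s lI] by (intro sum.cong) auto
    also have "\<dots> = 0" using 0 by (simp flip: sum_distrib_right)
    finally show ?thesis .
  qed
  moreover have "s - cell_mean n m s \<in> carrier_mat r n"
    using s by (intro minus_carrier_mat cell_mean_carrier)
  ultimately show ?thesis by (simp add: mat_inner_over_partition)
qed

text \<open>\<open>orth_proj\<close> is a definite description, so uniqueness has to be shown as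
  well. The difference \<open>w\<close> of two candidates lies in the space; subtracting their
  orthogonality relations tested on \<open>w\<close> leaves
  \<open>mat_inner w w = 0\<close>.\<close>

lemma orth_proj_eq_cell_mean:
  assumes s: "s \<in> carrier_mat r n"
  shows "orth_proj (tensor_step_space r n m) s = cell_mean n m s"
  unfolding orth_proj_def
proof (rule the_equality)
  let ?U = "tensor_step_space r n m"
  show "cell_mean n m s \<in> ?U \<and> (\<forall>v\<in>?U. mat_inner (s - cell_mean n m s) v = 0)"
    using cell_mean_in_tensor_step_space[OF s] cell_mean_orthogonal[OF s] by blast
  fix u assume u: "u \<in> ?U \<and> (\<forall>v\<in>?U. mat_inner (s - u) v = 0)"
  have dims: "u \<in> carrier_mat r n" "cell_mean n m s \<in> carrier_mat r n"
    using u s by (auto simp: tensor_step_space_def cell_mean_carrier)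
  define w where "w = cell_mean n m s - u"
  have w: "w \<in> carrier_mat r n" using dims unfolding w_def by (intro minus_carrier_mat)
  have "w $$ (l, i) = w $$ (l, i')"
    if "l < r" "I \<in> m" "Suc i \<in> I" "Suc i' \<in> I" for l I i i'
  proof -
    have "u $$ (l, i) = u $$ (l, i')"
      using u that unfolding tensor_step_space_eq by blast
    moreover have "i < n" "i' < n" using that cell_index_less by blast+
    moreover have "cell_mean n m s $$ (l, i) = cell_mean n m s $$ (l, i')"
      using that s by (simp add: cell_mean_index)
    ultimately show ?thesis
      using \<open>l < r\<close> dims by (simp add: w_def)
  qed
  then have "w \<in> ?U" using w unfolding tensor_step_space_eq by blast
  then have "mat_inner (s - u) w - mat_inner (s - cell_mean n m s) w = 0"
    using u cell_mean_orthogonal[OF s] by simp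
  moreover have "mat_inner (s - u) w - mat_inner (s - cell_mean n m s) w = mat_inner w w"
    using s dims by (simp add: mat_inner_def w_def algebra_simps flip: sum_subtractf)
  ultimately have "(\<Sum>i<n. \<Sum>l<r. w $$ (l, i) * w $$ (l, i)) = 0"
    using w by (simp add: mat_inner_def)
  then have "w $$ (l, i) = 0" if "i < n" "l < r" for l i
    using that by (simp add: sum_nonneg_eq_0_iff sum_nonneg)
  then show "u = cell_mean n m s"
    using dims by (intro eq_matI) (auto simp: w_def)
qed

lemma mat_norm_minus_orth_proj:
  assumes s: "s \<in> carrier_mat r n"
  shows "(mat_norm (s - orth_proj (tensor_step_space r n m) s))\<^sup>2 = (\<Sum>I\<in>m. mat_dev s I)"
proof -
  have "mat_inner (s - cell_mean n m s) (s - cell_mean n m s) =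
      (\<Sum>l<r. \<Sum>I\<in>m. \<Sum>i\<in>I. ((s - cell_mean n m s) $$ (l, i - 1))\<^sup>2)"
    using s by (subst mat_inner_over_partition[of _ r])
       (auto simp: power2_eq_square intro!: minus_carrier_mat cell_mean_carrier)
  also have "\<dots> = (\<Sum>l<r. \<Sum>I\<in>m. sq_dev (\<lambda>i. s $$ (l, i - 1)) I)"
    unfolding sq_dev_def using minus_cell_mean_index[OF s] by (intro sum.cong) auto
  also have "\<dots> = (\<Sum>I\<in>m. mat_dev s I)"
    using s unfolding mat_dev_def by (subst sum.swap) simp
  finally have "mat_inner (s - cell_mean n m s) (s - cell_mean n m s) = (\<Sum>I\<in>m. mat_dev s I)" .
  then show ?thesis
    by (simp add: mat_norm_def orth_proj_eq_cell_mean[OF s] sum_nonneg mat_dev_nonneg)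
qed

end

subsection \<open>Approximation in Besov bodies\<close>

text \<open>Induction upwards from the leaves, where \<open>V\<close> vanishes. Subadditivity is
  applied twice: to separate \<open>b\<close> from the two children, then the children from each
  other.\<close>

lemma subtree_energy_le:
  fixes b V :: "nat \<Rightarrow> nat \<Rightarrow> real"
  assumes p: "0 < p" "p \<le> 2" and q: "0 \<le> q"
    and V_nonneg: "\<And>j k. 0 \<le> V j k" and b_nonneg: "\<And>j k. 0 \<le> b j k"
    and V_leaf: "\<And>k. V N k = 0"
    and V_split: "\<And>j k. j < N \<Longrightarrow> k < 2 ^ j \<Longrightarrow>
      V j k = (b j k)\<^sup>2 + (V (Suc j) (2 * k) + V (Suc j) (2 * k + 1))"
    and "j + d = N" "k < 2 ^ j"
  shows "V j k powr (p / 2) \<le> 2 powr - (real j * q) *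
    subtree_sum (\<lambda>j k. 2 powr (real j * q) * b j k powr p) d j k"
  using assms(8,9)
proof (induction d arbitrary: j k)
  case 0
  then show ?case using V_leaf by simp
next
  case (Suc d)
  let ?A = "subtree_sum (\<lambda>j k. 2 powr (real j * q) * b j k powr p) d (Suc j)"
  let ?e = "2 powr - (real j * q) :: real"
  have A_nonneg: "0 \<le> ?A k" for k by (intro subtree_sum_nonneg) auto
  have IH: "V (Suc j) k' powr (p / 2) \<le> ?e * ?A k'" if "k' < 2 ^ Suc j" for k'
  proof -
    have "V (Suc j) k' powr (p / 2) \<le> 2 powr - (real (Suc j) * q) * ?A k'"
      using Suc.prems that by (intro Suc.IH) auto
    \<comment> \<open>As \<open>q \<ge> 0\<close>, the factor of level \<open>Suc j\<close> is at
      most that of level \<open>j\<close>; after this relaxation all three terms share the factor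
      \<open>?e\<close>.\<close>
    also have "\<dots> \<le> ?e * ?A k'"
      using q A_nonneg by (intro mult_right_mono) (auto simp: algebra_simps)
    finally show ?thesis .
  qed
  have b: "((b j k)\<^sup>2) powr (p / 2) = b j k powr p"
    using b_nonneg[of j k] by (cases "b j k = 0") (simp_all add: powr_powr flip: powr_numeral)
  have sub: "(x + y) powr (p / 2) \<le> x powr (p / 2) + y powr (p / 2)"
    if "0 \<le> x" "0 \<le> y" for x y :: real
    using p that by (intro powr_add_le_add_powr) auto
  have "V j k powr (p / 2) =
      ((b j k)\<^sup>2 + (V (Suc j) (2 * k) + V (Suc j) (2 * k + 1))) powr (p / 2)"
    using Suc.prems by (subst V_split) auto
  also have "\<dots> \<le> ((b j k)\<^sup>2) powr (p / 2) +
      (V (Suc j) (2 * k) + V (Suc j) (2 * k + 1)) powr (p / 2)"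
    using V_nonneg by (intro sub) auto
  also have "\<dots> \<le> b j k powr p +
      (V (Suc j) (2 * k) powr (p / 2) + V (Suc j) (2 * k + 1) powr (p / 2))"
    unfolding b using V_nonneg by (intro add_left_mono sub) auto
  also have "\<dots> \<le> b j k powr p + (?e * ?A (2 * k) + ?e * ?A (2 * k + 1))"
    using Suc.prems by (intro add_left_mono add_mono IH) auto
  also have "\<dots> = ?e * subtree_sum (\<lambda>j k. 2 powr (real j * q) * b j k powr p) (Suc d) j k"
    unfolding subtree_sum_Suc by (simp add: distrib_left flip: powr_add mult.assoc)
  finally show ?case .
qed

text \<open>The first \<open>J\<close> levels, with \<open>2 ^ J\<close> between D/4 and D/2, are
  counted by \<open>2 ^ j\<close> and give at most D/2 - 1; the later ones are bounded by a
  geometric series of total at most D/2. In the constant, \<open>1 - 2 powr - q\<close> cancels the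
  sum of the series and \<open>4 powr q\<close> pays for \<open>D < 4 * 2 ^ J\<close>.\<close>

lemma sum_heavy_le:
  fixes h :: "nat \<Rightarrow> nat" and q :: real
  assumes q: "0 < q" and D: "1 \<le> D"
    and card_level: "\<And>j. j < N \<Longrightarrow> h j \<le> 2 ^ j"
    and decay: "\<And>j. j < N \<Longrightarrow> real (h j) \<le>
      (1 - 2 powr - q) / (2 * 4 powr q) * real D powr (1 + q) * 2 powr - (real j * q)"
  shows "1 + (\<Sum>j<N. h j) \<le> D"
proof -
  define z :: real where "z = 2 powr - q"
  have z: "0 < z" "z < 1" using q by (auto simp: z_def powr_less_one)
  have z_pow: "2 powr - (real j * q) = z ^ j" for j
    by (simp add: z_def powr_powr mult.commute flip: powr_realpow)
  define X where "X = (1 - z) / (2 * 4 powr q) * real D powr (1 + q)"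
  have X: "X > 0" using z D by (simp add: X_def)
  have decay': "real (h j) \<le> X * z ^ j" if "j < N" for j
    using decay[OF that] by (simp add: X_def z_pow flip: z_def)
  have four: "1 \<le> 4 powr q" using q by (intro ge_one_powr_ge_zero) auto
  show ?thesis
  proof (cases "D = 1")
    case True
    \<comment> \<open>No \<open>J\<close> satisfies \<open>2 * 2 ^ J \<le> 1\<close>, so
      \<open>D = 1\<close> is treated apart: the counts are integers below 1.\<close>
    have "X < 1" using True z four by (simp add: X_def divide_less_eq)
    have "h j = 0" if "j < N" for j
    proof -
      have "X * z ^ j \<le> X" using X z by (simp add: mult_le_cancel_left1 power_le_one)
      then have "real (h j) < 1" using decay'[OF that] \<open>X < 1\<close> by linarith
      then show ?thesis by simp
    qed
    then show ?thesis using True by simp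
  next
    case False
    then have "1 \<le> D div 2" using D by simp
    then obtain J where "2 ^ J \<le> D div 2" "D div 2 < 2 ^ (J + 1)"
      using ex_power_ivl1[of 2 "D div 2"] by auto
    then have "2 * 2 ^ J \<le> D" "D < 4 * 2 ^ J" by auto
    then have "real (2 * 2 ^ J) \<le> real D" "real D < real (4 * 2 ^ J)"
      by (simp_all only: of_nat_le_iff of_nat_less_iff)
    then have J: "2 * 2 ^ J \<le> real D" "real D < 4 * 2 ^ J" by simp_all
    have "real D powr q \<le> (4 * 2 ^ J) powr q"
      using J(2) q by (intro powr_mono2) auto
    also have "\<dots> = 4 powr q / z ^ J"
      by (simp add: powr_mult z_pow[symmetric] powr_minus_divide powr_powr flip: powr_realpow)
    finally have zJ: "z ^ J * real D powr q \<le> 4 powr q"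
      using z by (simp add: field_simps)
    have "(\<Sum>j<N. real (h j)) \<le> (\<Sum>j<J. 2 ^ j) + (\<Sum>i<N. X * z ^ (J + i))"
    proof -
      \<comment> \<open>The intersection of the two ranges also covers the case
        \<open>J > N\<close>, in which the second sum is empty.\<close>
      have "(\<Sum>j<N. real (h j)) \<le> (\<Sum>j\<in>{..<N} \<inter> {..<J}. real (h j)) + (\<Sum>j\<in>{J..<N}. real (h j))"
        by (subst sum.union_disjoint[symmetric]) (auto intro!: sum_mono2)
      also have "(\<Sum>j\<in>{..<N} \<inter> {..<J}. real (h j)) \<le> (\<Sum>j\<in>{..<N} \<inter> {..<J}. 2 ^ j)"
      proof (intro sum_mono)
        fix j assume "j \<in> {..<N} \<inter> {..<J}"
        then have "h j \<le> 2 ^ j" by (intro card_level) auto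
        then have "real (h j) \<le> real (2 ^ j)" by (simp only: of_nat_le_iff)
        then show "real (h j) \<le> 2 ^ j" by simp
      qed
      also have "\<dots> \<le> (\<Sum>j<J. 2 ^ j)" by (intro sum_mono2) auto
      also have "(\<Sum>j\<in>{J..<N}. real (h j)) \<le> (\<Sum>j\<in>{J..<N}. X * z ^ j)"
        by (intro sum_mono decay') auto
      also have "\<dots> \<le> (\<Sum>j\<in>{J..<J + N}. X * z ^ j)"
        using X z by (intro sum_mono2) auto
      also have "\<dots> = (\<Sum>i<N. X * z ^ (J + i))"
        by (rule sum.reindex_bij_witness[of _ "\<lambda>i. J + i" "\<lambda>j. j - J"]) auto
      finally show ?thesis by simp
    qed
    also have "(\<Sum>j<J. 2 ^ j) = (2 ^ J - 1 :: real)"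
      by (induction J) auto
    also have "(\<Sum>i<N. X * z ^ (J + i)) \<le> real D / 2"
    proof -
      have "(\<Sum>i<N. X * z ^ (J + i)) = X * z ^ J * (\<Sum>i<N. z ^ i)"
        by (simp add: sum_distrib_left power_add mult.assoc)
      also have "\<dots> = X * z ^ J * ((1 - z ^ N) / (1 - z))"
        using z by (simp add: sum_gp_strict)
      also have "\<dots> \<le> X * z ^ J * (1 / (1 - z))"
        using X z by (intro mult_left_mono divide_right_mono) auto
      also have "\<dots> = real D * (z ^ J * real D powr q) / (2 * 4 powr q)"
        using z D by (simp add: X_def powr_add)
      also have "\<dots> \<le> real D * 4 powr q / (2 * 4 powr q)"
        using zJ by (intro divide_right_mono mult_left_mono) auto
      also have "\<dots> = real D / 2" by simp
      finally show ?thesis .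
    qed
    finally have "(\<Sum>j<N. real (h j)) \<le> 2 ^ J - 1 + real D / 2" by simp
    with J(1) have "real (1 + (\<Sum>j<N. h j)) \<le> real D" by simp
    then show ?thesis by (simp only: of_nat_le_iff)
  qed
qed

lemma besov_approximation:
  fixes p \<alpha> R :: real
  assumes p: "0 < p" "p \<le> 2" and \<alpha>: "\<alpha> > 1/p - 1/2" and R: "R > 0" and D: "D \<in> {1..2 ^ N}"
    and s: "s \<in> besov_body r N \<alpha> p R"
  defines "q \<equiv> p * (\<alpha> + 1/2 - 1/p)"
  defines "c \<equiv> (1 - 2 powr - q) / (2 * 4 powr q)"
  shows "\<exists>m\<in>dyadic_partitions N. card m = D \<and>
    (\<Sum>I\<in>m. mat_dev s I) \<le> c powr (- 2 / p) * 2 ^ N * R\<^sup>2 * real D powr (- 2 * \<alpha>)"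
proof -
  define b where "b j k = vec_norm2 (haar_coeff s j k)" for j k
  define w where "w = (\<lambda>j k. 2 powr (real j * q) * b j k powr p)"
  define M where "M = sqrt (2 ^ N) * R"
  \<comment> \<open>\<open>X\<close> is the bound that \<open>sum_heavy_le\<close> requires on level
    0, and \<open>\<tau>\<close> is chosen so that \<open>M powr p / \<tau> = X\<close>.\<close>
  define X where "X = c * real D powr (1 + q)"
  define \<tau> where "\<tau> = M powr p / X"
  define heavy where "heavy j k \<longleftrightarrow> \<tau> < 2 powr - (real j * q) * subtree_sum w (N - j) j k" for j k
  have s_carrier: "s \<in> carrier_mat r (2 ^ N)" using s by (simp add: besov_body_def)
  have q: "0 < q" using p \<alpha> by (simp add: q_def)
  have c: "0 < c" using q by (simp add: c_def powr_less_one)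
  have M: "0 < M" using R by (simp add: M_def)
  have X: "0 < X" using c D by (simp add: X_def)
  have \<tau>: "0 < \<tau>" using M X by (simp add: \<tau>_def)
  have w_nonneg: "0 \<le> w j k" for j k by (simp add: w_def)

  have "subtree_sum w N 0 0 powr (1 / p) \<le> M"
    using s by (simp add: besov_body_def subtree_sum_root w_def M_def b_def q_def
        sum_distrib_left mult.assoc)
  then have "(subtree_sum w N 0 0 powr (1 / p)) powr p \<le> M powr p"
    using p by (intro powr_mono2) auto
  then have root: "subtree_sum w N 0 0 \<le> M powr p"
    using p subtree_sum_nonneg[of w N 0 0] w_nonneg by (simp add: powr_powr)

  have energy: "mat_dev s (dyadic N j k) powr (p / 2) \<le>
      2 powr - (real j * q) * subtree_sum w (N - j) j k" if "j \<le> N" "k < 2 ^ j" for j k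
    unfolding w_def using that p q
    by (intro subtree_energy_le[where V = "\<lambda>j k. mat_dev s (dyadic N j k)"])
       (auto simp: mat_dev_nonneg mat_dev_dyadic_finest b_def vec_norm2_def
         scalar_prod_def sum_nonneg mat_dev_dyadic_split[OF s_carrier])

  \<comment> \<open>On level \<open>N\<close> the cell is a single point with zero deviation;
    elsewhere the energy bound is below the threshold.\<close>
  have light: "mat_dev s (dyadic N j k) \<le> \<tau> powr (2 / p)"
    if "j \<le> N" "k < 2 ^ j" "j = N \<or> \<not> heavy j k" for j k
  proof (cases "j = N")
    case False
    then have "mat_dev s (dyadic N j k) powr (p / 2) \<le> \<tau>"
      using energy[OF that(1,2)] that(3) by (simp add: heavy_def)
    then have "(mat_dev s (dyadic N j k) powr (p / 2)) powr (2 / p) \<le> \<tau> powr (2 / p)"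
      using p by (intro powr_mono2) auto
    then show ?thesis using p by (simp add: powr_powr mat_dev_nonneg)
  qed (simp add: mat_dev_dyadic_finest)

  have "1 + (\<Sum>j<N. \<Sum>k<2 ^ j. of_bool (heavy j k)) \<le> D"
  proof (rule sum_heavy_le[OF q])
    fix j assume j: "j < N"
    let ?h = "\<Sum>k<2 ^ j. of_bool (heavy j k) :: nat"
    have "?h \<le> (\<Sum>k<(2::nat) ^ j. 1)" by (intro sum_mono) auto
    then show "?h \<le> 2 ^ j" by simp
    \<comment> \<open>Markov's inequality on one level: every heavy node has more than
      \<open>\<tau>\<close>, and the subtree sums of the level add up to at most
      \<open>M powr p\<close>.\<close>
    have "real ?h * \<tau> = (\<Sum>k<2 ^ j. of_bool (heavy j k) * \<tau>)"
      by (simp add: sum_distrib_right)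
    also have "\<dots> \<le> (\<Sum>k<2 ^ j. 2 powr - (real j * q) * subtree_sum w (N - j) j k)"
      using subtree_sum_nonneg[of w] w_nonneg by (intro sum_mono) (auto simp: heavy_def)
    also have "\<dots> = 2 powr - (real j * q) * (\<Sum>k<2 ^ j. subtree_sum w (N - j) j k)"
      by (simp add: sum_distrib_left)
    also have "\<dots> \<le> 2 powr - (real j * q) * M powr p"
      using sum_subtree_sum_le_root[of w j N] w_nonneg j root by (intro mult_left_mono) auto
    finally have "real ?h \<le> X * 2 powr - (real j * q)"
      using X M by (simp add: \<tau>_def field_simps)
    then show "real ?h \<le>
        (1 - 2 powr - q) / (2 * 4 powr q) * real D powr (1 + q) * 2 powr - (real j * q)"
      by (simp add: X_def c_def)
  qed (use D in auto)
  then have "1 + subtree_sum (\<lambda>j k. of_bool (heavy j k)) N 0 0 \<le> D"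
    by (simp add: subtree_sum_root)
  \<comment> \<open>Membership in \<open>dyadic_intervals\<close> is carried along in
    \<open>P\<close>, since the adaptive construction by itself only returns a set
    partition.\<close>
  moreover obtain m where m: "partition_on (dyadic N 0 0) m"
    "\<forall>I\<in>m. I \<in> dyadic_intervals N \<and> mat_dev s I \<le> \<tau> powr (2 / p)"
    "card m \<le> 1 + subtree_sum (\<lambda>j k. of_bool (heavy j k)) N 0 0"
    using adaptive_dyadic_partition[where j = 0 and k = 0 and d = N and N = N and heavy = heavy
        and P = "\<lambda>I. I \<in> dyadic_intervals N \<and> mat_dev s I \<le> \<tau> powr (2 / p)"]
      light dyadic_in_dyadic_intervals by auto
  ultimately have card_m: "card m \<le> D" by simp
  have m_dyadic: "m \<in> dyadic_partitions N"
    using m(1,2) by (auto simp: dyadic_partitions_def dyadic_def)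
  have "\<exists>m'\<in>dyadic_partitions N. card m' = D \<and> (\<Sum>I\<in>m'. mat_dev s I) \<le> (\<Sum>I\<in>m. mat_dev s I)"
    using m_dyadic card_m D
    by (intro refine_dyadic_partition_to_card) (auto simp: mat_dev_dyadic_split[OF s_carrier])
  moreover have "(\<Sum>I\<in>m. mat_dev s I) \<le>
      c powr (- 2 / p) * 2 ^ N * R\<^sup>2 * real D powr (- 2 * \<alpha>)"
  proof -
    have "(\<Sum>I\<in>m. mat_dev s I) \<le> real (card m) * \<tau> powr (2 / p)"
      using m(2) by (intro sum_bounded_above) auto
    also have "\<dots> \<le> real D * \<tau> powr (2 / p)"
      using card_m by (intro mult_right_mono) auto
    also have "\<tau> powr (2 / p) = (M powr p) powr (2 / p) / X powr (2 / p)"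
      using X by (simp add: \<tau>_def powr_divide)
    also have "(M powr p) powr (2 / p) = 2 ^ N * R\<^sup>2"
      using p M by (simp add: powr_powr) (simp add: M_def power_mult_distrib)
    \<comment> \<open>Since \<open>1 + q = p * (\<alpha> + 1/2)\<close>, the exponent of
      \<open>D\<close> becomes \<open>2 * \<alpha> + 1\<close>; its extra 1 pays for the factor
      \<open>D\<close> from the number of cells.\<close>
    also have "X powr (2 / p) = c powr (2 / p) * real D powr (2 * \<alpha> + 1)"
    proof -
      have "(1 + q) * (2 / p) = 2 * \<alpha> + 1" using p by (simp add: q_def field_simps)
      then show ?thesis using c by (simp add: X_def powr_mult powr_powr)
    qed
    also have "real D * (2 ^ N * R\<^sup>2 / (c powr (2 / p) * real D powr (2 * \<alpha> + 1))) =
        c powr (- 2 / p) * 2 ^ N * R\<^sup>2 * real D powr (- 2 * \<alpha>)"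
      using D c by (simp add: powr_add powr_minus field_simps)
    finally show ?thesis .
  qed
  ultimately show ?thesis by fastforce
qed

theorem theorem1:
  fixes p \<alpha> :: real
  assumes "0 < p" "p \<le> 2" "\<alpha> > 1/p - 1/2"
  shows "\<exists>C::real. C > 0 \<and>
    (\<forall>(R::real) (r::nat) (N::nat) (D::nat).
       R > 0 \<longrightarrow> r \<ge> 2 \<longrightarrow> D \<in> {1..2 ^ N} \<longrightarrow>
       (SUP s \<in> besov_prob_mats r N \<alpha> p R.
          INF m \<in> dyadic_partitions_dim N D.
            ereal ((mat_norm (s - orth_proj (tensor_step_space r (2 ^ N) m) s))\<^sup>2))
       \<le> ereal (C * 2 ^ N * R\<^sup>2 * real D powr (- 2 * \<alpha>)))"
proof -
  define q where "q = p * (\<alpha> + 1/2 - 1/p)"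
  \<comment> \<open>This depends on \<open>\<alpha>\<close> and \<open>p\<close> alone, so
    \<open>C = c powr (- 2 / p)\<close> can be fixed before \<open>R\<close>, \<open>r\<close>,
    \<open>N\<close> and \<open>D\<close>.\<close>
  define c where "c = (1 - 2 powr - q) / (2 * 4 powr q)"
  have "q > 0" using assms by (simp add: q_def)
  then have "c > 0" by (simp add: c_def powr_less_one)
  show ?thesis
  proof (intro exI[of _ "c powr (- 2 / p)"] conjI allI impI SUP_least)
    show "0 < c powr (- 2 / p)" using \<open>c > 0\<close> by simp
  next
    fix R :: real and r N D :: nat and s
    assume R: "R > 0" and D: "D \<in> {1..2 ^ N}" and s: "s \<in> besov_prob_mats r N \<alpha> p R"
    have s_body: "s \<in> besov_body r N \<alpha> p R" and s_carrier: "s \<in> carrier_mat r (2 ^ N)"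
      using s by (auto simp: besov_prob_mats_def besov_body_def)
    obtain m where m: "m \<in> dyadic_partitions N" "card m = D"
      "(\<Sum>I\<in>m. mat_dev s I) \<le> c powr (- 2 / p) * 2 ^ N * R\<^sup>2 * real D powr (- 2 * \<alpha>)"
      using besov_approximation[OF assms R D s_body] unfolding c_def q_def by blast
    have part: "partition_on {1..2 ^ N} m" using m(1) by (simp add: dyadic_partitions_def)
    show "(INF m \<in> dyadic_partitions_dim N D.
        ereal ((mat_norm (s - orth_proj (tensor_step_space r (2 ^ N) m) s))\<^sup>2))
        \<le> ereal (c powr (- 2 / p) * 2 ^ N * R\<^sup>2 * real D powr (- 2 * \<alpha>))"
    proof (rule INF_lower2)
      show "m \<in> dyadic_partitions_dim N D"
        using m(1,2) step_dim_eq_card[OF part] by (simp add: dyadic_partitions_dim_def)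
      show "ereal ((mat_norm (s - orth_proj (tensor_step_space r (2 ^ N) m) s))\<^sup>2)
          \<le> ereal (c powr (- 2 / p) * 2 ^ N * R\<^sup>2 * real D powr (- 2 * \<alpha>))"
        using m(3) by (simp add: mat_norm_minus_orth_proj[OF part s_carrier])
    qed
  qed
qed

end
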